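(* Let $\alpha>0$, $n\in\mathbb N=\{1,2,\dots\}$, $0<a<b$, and let $x:[a,b]\to\mathbb R$ be a function of class $C^{n+1}$. Then for every $t\in\,]a,b[$, $$ {_t\mathcal{I}_b^\alpha} x(t)=\sum_{i=0}^{n}A_i(\alpha)\left(\ln\frac{b}{t}\right)^{\alpha+i} x_{i,0}(t)+\sum_{p=n+1}^\infty B(\alpha,p)\left(\ln\frac{b}{t}\right)^{\alpha+n-p}W_p(t), $$ (the series, including those defining $A_i(\alpha)$, being convergent), where $$ A_i(\alpha)=\frac{(-1)^i}{\Gamma(\alpha+i+1)}\left[1+\sum_{p=n-i+1}^\infty\frac{\Gamma(p-\alpha-n)}{\Gamma(-\alpha-i)(p-n+i)!}\right],\quad B(\alpha,p)=\frac{\Gamma(p-\alpha-n)}{\Gamma(\alpha)\Gamma(1-\alpha)(p-n)!}, $$ $$ W_p(t)=\int_t^b (p-n)\left(\ln\frac{b}{\tau}\right)^{p-n-1}\frac{x(\tau)}{\tau}\,d\tau . $$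
   Context: For $0<a<b$, $\alpha>0$ and integrable $x:[a,b]\to\mathbb R$, the right Hadamard fractional integral of order $\alpha$ is $$ {_t\mathcal{I}_b^\alpha} x(t)=\frac{1}{\Gamma(\alpha)}\int_t^b\left(\ln\frac{\tau}{t}\right)^{\alpha-1}\frac{x(\tau)}{\tau}\,d\tau,\quad t\in\,]a,b[. $$ The functions $x_{k,0}$ are defined recursively for $k\ge 0$ by $x_{0,0}(t)=x(t)$, $x_{k+1,0}(t)=t\frac{d}{dt}x_{k,0}(t)$. Convention on Gamma quotients (needed only when $\alpha$ is an integer, where the Gamma function has poles): $\frac{\Gamma(p-\alpha-n)}{\Gamma(-\alpha-i)}$ means $\prod_{j=0}^{p-n+i-1}(-\alpha-i+j)$, and $\frac{\Gamma(p-\alpha-n)}{\Gamma(1-\alpha)}$ means $\prod_{j=1}^{p-n-1}(j-\alpha)$ (an empty product being $1$); for non-integer $\alpha$ these are identities. *)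

theory Defs
  imports "HOL-Analysis.Analysis"
begin

text \<open>
  Functions on \<open>[a,b]\<close> are rendered as total functions on the reals; nothing below depends on
  values outside \<open>[a,b]\<close>. Derivatives in \<open>C_class\<close> are taken within \<open>S\<close>, hence are
  one-sided at the endpoints of an interval.
\<close>

fun C_class :: "nat \<Rightarrow> real set \<Rightarrow> (real \<Rightarrow> real) \<Rightarrow> bool" where
  "C_class 0 S f \<longleftrightarrow> continuous_on S f"
| "C_class (Suc k) S f \<longleftrightarrow>
     (\<exists>f'. (\<forall>s\<in>S. (f has_real_derivative f' s) (at s within S)) \<and> C_class k S f')"

definition right_hadamard_integral :: "real \<Rightarrow> real \<Rightarrow> (real \<Rightarrow> real) \<Rightarrow> real \<Rightarrow> real" where
  "right_hadamard_integral \<alpha> b x t =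
     1 / Gamma \<alpha> * (LBINT \<tau>:{t..b}. ln (\<tau> / t) powr (\<alpha> - 1) * (x \<tau> / \<tau>))"

text \<open>
  \<open>x_deriv k x\<close> is \<open>x\<^sub>k\<^sub>,\<^sub>0\<close>. It is meaningful at interior points of the interval
  only (\<open>deriv\<close> is two-sided), and there it depends only on \<open>x\<close> near the point.
\<close>

fun x_deriv :: "nat \<Rightarrow> (real \<Rightarrow> real) \<Rightarrow> real \<Rightarrow> real" where
  "x_deriv 0 x = x"
| "x_deriv (Suc k) x = (\<lambda>t. t * deriv (x_deriv k x) t)"

text \<open>
  The quotients \<open>\<Gamma>(p - \<alpha> - n) / \<Gamma>(-\<alpha> - i)\<close> and
  \<open>\<Gamma>(p - \<alpha> - n) / \<Gamma>(1 - \<alpha>)\<close>. For integer \<open>\<alpha>\<close>, where poles occur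
  (the library sets \<open>Gamma\<close> to 0 there), they stand for the products obtained by cancelling.
  Natural subtraction: \<open>p + i - n\<close> is the integer \<open>p - n + i\<close> since only
  \<open>p \<ge> n - i + 1\<close> is used, although \<open>p < n\<close> may occur.
\<close>

definition gamma_quot_A :: "real \<Rightarrow> nat \<Rightarrow> nat \<Rightarrow> nat \<Rightarrow> real" where
  "gamma_quot_A \<alpha> n i p =
     (if \<alpha> \<in> \<int> then \<Prod>j<p + i - n. (- \<alpha> - real i + real j)
      else Gamma (real p - \<alpha> - real n) / Gamma (- \<alpha> - real i))"

definition gamma_quot_B :: "real \<Rightarrow> nat \<Rightarrow> nat \<Rightarrow> real" where
  "gamma_quot_B \<alpha> n p =
     (if \<alpha> \<in> \<int> then \<Prod>j=1..p - n - 1. (real j - \<alpha>)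
      else Gamma (real p - \<alpha> - real n) / Gamma (1 - \<alpha>))"

lemma gamma_quot_A_eq_prod:
  assumes "n \<le> p + i"
  shows "gamma_quot_A \<alpha> n i p = (\<Prod>j<p + i - n. (- \<alpha> - real i + real j))"
proof (cases "\<alpha> \<in> \<int>")
  case False
  have "- \<alpha> - real i \<notin> \<int>"
  proof
    assume "- \<alpha> - real i \<in> \<int>"
    then have "- (- \<alpha> - real i) - real i \<in> \<int>" by (intro Ints_diff Ints_minus) auto
    with False show False by simp
  qed
  then have "- \<alpha> - real i \<notin> \<int>\<^sub>\<le>\<^sub>0" using nonpos_Ints_subset_Ints by blast
  from pochhammer_Gamma[OF this, of "p + i - n"] show ?thesis
    using False assms
    by (simp add: gamma_quot_A_def pochhammer_prod of_nat_diff algebra_simps atLeast0LessThan)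
qed (simp add: gamma_quot_A_def)

lemma gamma_quot_B_eq_prod:
  assumes "n < p"
  shows "gamma_quot_B \<alpha> n p = (\<Prod>j=1..p - n - 1. (real j - \<alpha>))"
proof (cases "\<alpha> \<in> \<int>")
  case False
  have "1 - \<alpha> \<notin> \<int>"
  proof
    assume "1 - \<alpha> \<in> \<int>"
    then have "1 - (1 - \<alpha>) \<in> \<int>" by (intro Ints_diff) auto
    with False show False by simp
  qed
  then have "1 - \<alpha> \<notin> \<int>\<^sub>\<le>\<^sub>0" using nonpos_Ints_subset_Ints by blast
  from pochhammer_Gamma[OF this, of "p - n - 1"]
  have "Gamma (real p - \<alpha> - real n) / Gamma (1 - \<alpha>) = (\<Prod>j<p - n - 1. (1 - \<alpha> + real j))"
    using assms by (simp add: pochhammer_prod of_nat_diff algebra_simps atLeast0LessThan)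
  also have "\<dots> = (\<Prod>j=1..p - n - 1. (real j - \<alpha>))"
    by (rule prod.reindex_bij_witness[of _ "\<lambda>j. j - 1" Suc]) (auto simp: of_nat_diff)
  finally show ?thesis using False by (simp add: gamma_quot_B_def)
qed (simp add: gamma_quot_B_def)

definition A_term :: "real \<Rightarrow> nat \<Rightarrow> nat \<Rightarrow> nat \<Rightarrow> real" where
  "A_term \<alpha> n i p = gamma_quot_A \<alpha> n i p / fact (p + i - n)"

text \<open>A series \<open>\<Sum>\<^sub>p\<^sub>\<ge>\<^sub>m f p\<close> is written as \<open>\<Sum>k. f (m + k)\<close>.\<close>

definition A_coeff :: "real \<Rightarrow> nat \<Rightarrow> nat \<Rightarrow> real" where
  "A_coeff \<alpha> n i =
     (-1) ^ i / Gamma (\<alpha> + real i + 1) * (1 + (\<Sum>k. A_term \<alpha> n i (n - i + 1 + k)))"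

definition B_coeff :: "real \<Rightarrow> nat \<Rightarrow> nat \<Rightarrow> real" where
  "B_coeff \<alpha> n p = gamma_quot_B \<alpha> n p / (Gamma \<alpha> * fact (p - n))"

definition W_moment :: "real \<Rightarrow> (real \<Rightarrow> real) \<Rightarrow> nat \<Rightarrow> nat \<Rightarrow> real \<Rightarrow> real" where
  "W_moment b x n p t =
     (LBINT \<tau>:{t..b}. real (p - n) * ln (b / \<tau>) ^ (p - n - 1) * (x \<tau> / \<tau>))"

definition B_term :: "real \<Rightarrow> real \<Rightarrow> (real \<Rightarrow> real) \<Rightarrow> nat \<Rightarrow> real \<Rightarrow> nat \<Rightarrow> real" where
  "B_term \<alpha> b x n t p =
     B_coeff \<alpha> n p * ln (b / t) powr (\<alpha> + real n - real p) * W_moment b x n p t"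

end

theory Submission
  imports Defs
begin

text \<open>
  With \<open>L = ln (b/t)\<close> and \<open>s = ln (b/\<tau>)\<close> the kernel is
  \<open>ln (\<tau>/t) powr (\<alpha> - 1) = (L - s) powr (\<alpha> - 1)\<close>, and the series of \<open>B\<close>-terms is just
  its binomial expansion in \<open>s/L\<close>, integrated term by term. The coefficients are \<open>O(q powr -\<alpha>)\<close>
  and the integral of \<open>(s/L) ^ q / \<tau>\<close> is \<open>L / (q + 1)\<close>, so the interchange is dominated
  even though the kernel may be singular at \<open>s = L\<close>. All the coefficients \<open>A_coeff\<close> vanish,
  the bracket in their definition being the binomial series of \<open>(1 - 1) powr (\<alpha> + i)\<close>.
\<close>

section \<open>Binomial coefficients: partial sums and decay\<close>

text \<open>The summands are the Taylor coefficients of (1 - z) powr \<beta>. Taking partial sums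
  amounts to dividing by 1 - z, which gives the coefficients of (1 - z) powr (\<beta> - 1).\<close>

lemma sum_pochhammer_over_fact:
  fixes \<beta> :: "'a :: field_char_0"
  shows "(\<Sum>q\<le>N. pochhammer (- \<beta>) q / fact q) = pochhammer (1 - \<beta>) N / fact N"
proof (induction N)
  case (Suc N)
  have "(\<Sum>q\<le>Suc N. pochhammer (- \<beta>) q / fact q)
      = pochhammer (1 - \<beta>) N / fact N - \<beta> * pochhammer (1 - \<beta>) N / fact (Suc N)"
    by (simp add: Suc.IH pochhammer_rec)
  also have "\<dots> = pochhammer (1 - \<beta>) N * (of_nat (Suc N) - \<beta>) / fact (Suc N)"
    unfolding fact_Suc by (simp add: divide_simps del: of_nat_Suc) (simp add: algebra_simps)
  finally show ?case
    by (simp add: pochhammer_rec' algebra_simps)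
qed simp

text \<open>The product formula for 1/Gamma at -\<beta> converges, so it is bounded; up to the
  factor -\<beta>, which must be divided out, it is the ratio of the two sides.\<close>

lemma pochhammer_over_fact_bound:
  fixes \<beta> :: real
  assumes "\<beta> \<noteq> 0"
  obtains K where "\<And>q. q > 0 \<Longrightarrow> \<bar>pochhammer (1 - \<beta>) q / fact q\<bar> \<le> K * real q powr (- \<beta>)"
proof -
  have "Bseq (rGamma_series (- \<beta>))"
    using rGamma_series_LIMSEQ convergent_def convergent_imp_Bseq by blast
  then obtain K where K: "\<And>q. norm (rGamma_series (- \<beta>) q) \<le> K"
    unfolding Bseq_def by blast
  have "\<bar>pochhammer (1 - \<beta>) q / fact q\<bar> \<le> (K / \<bar>\<beta>\<bar>) * real q powr (- \<beta>)" if "q > 0" for q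
  proof -
    \<comment> \<open>The numerator \<open>pochhammer (- \<beta>) (q + 1)\<close> of the series
      splits off its first factor -\<beta>.\<close>
    have "rGamma_series (- \<beta>) q
        = - \<beta> * (pochhammer (1 - \<beta>) q / fact q) / real q powr (- \<beta>)"
      using that unfolding rGamma_series_def Suc_eq_plus1[symmetric] pochhammer_rec
      by (simp add: powr_def)
    then have "\<bar>\<beta>\<bar> * \<bar>pochhammer (1 - \<beta>) q / fact q\<bar> / real q powr (- \<beta>) \<le> K"
      using K[of q] by (simp add: abs_mult)
    then show ?thesis
      using that assms by (simp add: field_simps)
  qed
  then show thesis by (rule that)
qed

lemma pochhammer_over_fact_tendsto_0:
  fixes \<beta> :: real
  assumes "\<beta> > 0"
  shows "(\<lambda>q. pochhammer (1 - \<beta>) q / fact q) \<longlonglongrightarrow> 0"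
proof -
  obtain K where K: "\<And>q. q > 0 \<Longrightarrow> \<bar>pochhammer (1 - \<beta>) q / fact q\<bar> \<le> K * real q powr (- \<beta>)"
    using pochhammer_over_fact_bound[of \<beta>] assms by auto
  have "(\<lambda>q. K * real q powr (- \<beta>)) \<longlonglongrightarrow> K * 0"
    using assms by (intro tendsto_mult tendsto_const tendsto_neg_powr filterlim_real_sequentially) auto
  then have "(\<lambda>q. K * real q powr (- \<beta>)) \<longlonglongrightarrow> 0"
    by simp
  moreover have "\<forall>\<^sub>F q in sequentially.
      norm (pochhammer (1 - \<beta>) q / fact q) \<le> K * real q powr (- \<beta>)"
    unfolding real_norm_def using eventually_gt_at_top[of 0] by eventually_elim (rule K)
  ultimately show ?thesis
    by (rule Lim_null_comparison[rotated])
qed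

lemma sums_pochhammer_over_fact:
  fixes \<beta> :: real
  assumes "\<beta> > 0"
  shows "(\<lambda>q. pochhammer (- \<beta>) q / fact q) sums 0"
  unfolding sums_def_le sum_pochhammer_over_fact
  by (rule pochhammer_over_fact_tendsto_0[OF assms])

text \<open>The divisor \<open>Suc q\<close> is the one produced by
  \<open>integral_ln_power_over\<close>. It improves the order q powr -\<alpha>, not summable for
  \<alpha> \<le> 1, to q powr (-\<alpha> - 1).\<close>

lemma summable_pochhammer_over_fact_Suc:
  fixes \<alpha> :: real
  assumes "\<alpha> > 0"
  shows "summable (\<lambda>q. \<bar>pochhammer (1 - \<alpha>) q / fact q\<bar> / real (Suc q))"
proof -
  obtain K where K: "\<And>q. q > 0 \<Longrightarrow> \<bar>pochhammer (1 - \<alpha>) q / fact q\<bar> \<le> K * real q powr (- \<alpha>)"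
    using pochhammer_over_fact_bound[of \<alpha>] assms by auto
  have "summable (\<lambda>q. K * real q powr (- \<alpha> - 1))"
    using assms by (intro summable_mult) (simp add: summable_real_powr_iff)
  then show ?thesis
  proof (rule summable_comparison_test_ev[rotated])
    have "\<bar>pochhammer (1 - \<alpha>) q / fact q\<bar> / real (Suc q) \<le> K * real q powr (- \<alpha> - 1)"
      if "q > 0" for q
    proof -
      have "\<bar>pochhammer (1 - \<alpha>) q / fact q\<bar> / real (Suc q)
          \<le> \<bar>pochhammer (1 - \<alpha>) q / fact q\<bar> / real q"
        using that by (intro divide_left_mono) auto
      also have "\<dots> \<le> K * real q powr (- \<alpha>) / real q"
        using K[OF that] by (intro divide_right_mono) auto
      also have "\<dots> = K * real q powr (- \<alpha> - 1)"
        using that by (simp add: powr_diff)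
      finally show ?thesis .
    qed
    then show "\<forall>\<^sub>F q in sequentially.
        norm (\<bar>pochhammer (1 - \<alpha>) q / fact q\<bar> / real (Suc q)) \<le> K * real q powr (- \<alpha> - 1)"
      by (intro eventually_mono[OF eventually_gt_at_top[of 0]]) simp
  qed
qed

section \<open>Expanding the kernel and integrating term by term\<close>

text \<open>Under s = ln (b/\<tau>) this is the integral of s ^ q from 0 to ln (b/t), which suggests
  the antiderivative.\<close>

lemma integral_ln_power_over:
  fixes t b :: real
  assumes "0 < t" "t \<le> b"
  shows "(LBINT \<tau>:{t..b}. ln (b / \<tau>) ^ q / \<tau>) = ln (b / t) ^ Suc q / real (Suc q)"
proof -
  have "((\<lambda>\<tau>. - ((ln b - ln \<tau>) ^ Suc q / real (Suc q))) has_real_derivative ln (b / \<tau>) ^ q / \<tau>)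
      (at \<tau> within {t..b})" if "t \<le> \<tau>" "\<tau> \<le> b" for \<tau>
  proof -
    have "0 < \<tau>" "0 < b" using assms that by auto
    then show ?thesis
      by (auto intro!: derivative_eq_intros simp: ln_div divide_simps simp del: power_Suc of_nat_Suc)
  qed
  then have "(LBINT \<tau>:{t..b}. ln (b / \<tau>) ^ q / \<tau>)
      = - ((ln b - ln b) ^ Suc q / real (Suc q)) - - ((ln b - ln t) ^ Suc q / real (Suc q))"
    unfolding set_lebesgue_integral_def using assms
    by (intro integral_FTC_atLeastAtMost)
      (auto simp: has_real_derivative_iff_has_vector_derivative intro!: continuous_intros)
  then show ?thesis
    using assms by (simp add: ln_div)
qed

text \<open>Since ln (\<tau>/t) = L * (1 - z), this is the binomial series at z. The strict
  inequality t < \<tau> keeps z below 1.\<close>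

lemma ln_kernel_sums:
  fixes t b \<tau> \<alpha> :: real
  assumes "0 < t" "t < \<tau>" "\<tau> \<le> b"
  shows "(\<lambda>q. pochhammer (1 - \<alpha>) q / fact q * (ln (b / \<tau>) / ln (b / t)) ^ q)
      sums (ln (\<tau> / t) powr (\<alpha> - 1) / ln (b / t) powr (\<alpha> - 1))"
    and "summable (\<lambda>q. \<bar>pochhammer (1 - \<alpha>) q / fact q * (ln (b / \<tau>) / ln (b / t)) ^ q\<bar>)"
proof -
  define L z where "L = ln (b / t)" and "z = ln (b / \<tau>) / L"
  have L: "L > 0" using assms by (simp add: L_def)
  have z: "0 \<le> z" "z < 1" using assms by (auto simp: z_def L_def divide_simps)
  have ln_split: "ln (\<tau> / t) = L * (1 - z)"
  proof -
    have "L * z = ln (b / \<tau>)" using L by (simp add: z_def)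
    then show ?thesis using assms by (simp add: right_diff_distrib L_def ln_div)
  qed
  have *: "(\<lambda>q. pochhammer (1 - \<alpha>) q / fact q * y ^ q) sums (1 - y) powr (\<alpha> - 1)"
    if "\<bar>y\<bar> < 1" for y :: real
  proof -
    have "((\<alpha> - 1) gchoose q) * (- y) ^ q = pochhammer (1 - \<alpha>) q / fact q * y ^ q" for q
      by (simp add: gbinomial_pochhammer power_minus[of y])
    with gen_binomial_real[of "- y" "\<alpha> - 1"] that show ?thesis by simp
  qed
  from *[of z] z L show "(\<lambda>q. pochhammer (1 - \<alpha>) q / fact q * (ln (b / \<tau>) / ln (b / t)) ^ q)
      sums (ln (\<tau> / t) powr (\<alpha> - 1) / ln (b / t) powr (\<alpha> - 1))"
    unfolding ln_split z_def[symmetric] L_def[symmetric] by (simp add: powr_mult)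
  \<comment> \<open>The midpoint of z and 1 lies strictly beyond z inside the disc of convergence;
    convergence there gives absolute convergence at z.\<close>
  have "summable (\<lambda>q. pochhammer (1 - \<alpha>) q / fact q * ((1 + z) / 2) ^ q)"
    using *[of "(1 + z) / 2"] z by (auto simp: sums_iff)
  from powser_insidea[OF this, of z] z
  show "summable (\<lambda>q. \<bar>pochhammer (1 - \<alpha>) q / fact q * (ln (b / \<tau>) / ln (b / t)) ^ q\<bar>)"
    unfolding z_def[symmetric] L_def[symmetric] by simp
qed

text \<open>Termwise integration needs summable L1 norms of the terms. A bound M for |x| and the
  exact integral of the log powers provide them; no bound on the kernel itself is used.\<close>

lemma ln_kernel_integral_sums:
  fixes t b \<alpha> :: real and x :: "real \<Rightarrow> real"
  assumes "\<alpha> > 0" "0 < t" "t < b" and cont: "continuous_on {t..b} x"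
  shows "(\<lambda>q. pochhammer (1 - \<alpha>) q / fact q * (ln (b / t) powr (\<alpha> - 1) / ln (b / t) ^ q) *
           (LBINT \<tau>:{t..b}. ln (b / \<tau>) ^ q * (x \<tau> / \<tau>)))
      sums (LBINT \<tau>:{t..b}. ln (\<tau> / t) powr (\<alpha> - 1) * (x \<tau> / \<tau>))"
proof -
  define L P c where "L = ln (b / t)" and "P = L powr (\<alpha> - 1)"
    and "c = (\<lambda>q. pochhammer (1 - \<alpha>) q / fact q)"
  have L: "L > 0" and P: "P > 0" using assms by (auto simp: L_def P_def)
  define g where "g = (\<lambda>q \<tau>. ln (b / \<tau>) ^ q * (x \<tau> / \<tau>))"
  define f where "f = (\<lambda>q \<tau>. indicator {t..b} \<tau> * (P / L ^ q * c q * g q \<tau>))"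
  have ln_nonneg: "0 \<le> ln (b / \<tau>)" if "\<tau> \<in> {t..b}" for \<tau>
    using that assms by simp
  have g_int: "set_integrable lborel {t..b} (g q)" for q
    unfolding g_def using assms
    by (intro borel_integrable_atLeastAtMost') (auto intro!: continuous_intros)
  have f_eq: "f q = (\<lambda>\<tau>. (P / L ^ q * c q) * (indicator {t..b} \<tau> * g q \<tau>))" for q
    by (auto simp: f_def)
  have f_int: "integrable lborel (f q)" for q
    using g_int[of q] unfolding f_eq set_integrable_def by auto
  have f_integral: "integral\<^sup>L lborel (f q) = c q * (P / L ^ q) * (LBINT \<tau>:{t..b}. g q \<tau>)" for q
    unfolding f_eq set_lebesgue_integral_def by (simp add: mult_ac)
  obtain M where M: "\<And>\<tau>. \<tau> \<in> {t..b} \<Longrightarrow> \<bar>x \<tau>\<bar> \<le> M"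
    using compact_imp_bounded[OF compact_continuous_image[OF cont compact_Icc]]
    unfolding bounded_iff real_norm_def by blast
  have M0: "M \<ge> 0" using M[of t] assms by auto
  have norm_le: "(\<integral>\<tau>. norm (f q \<tau>) \<partial>lborel) \<le> P * M * L * (\<bar>c q\<bar> / real (Suc q))" for q
  proof -
    define h where "h = (\<lambda>\<tau>. indicator {t..b} \<tau> *\<^sub>R (ln (b / \<tau>) ^ q / \<tau>))"
    have h_int: "integrable lborel h"
      unfolding h_def set_integrable_def[symmetric] using assms
      by (intro borel_integrable_atLeastAtMost') (auto intro!: continuous_intros)
    have "(\<integral>\<tau>. norm (f q \<tau>) \<partial>lborel) \<le> (\<integral>\<tau>. (P / L ^ q * \<bar>c q\<bar> * M) * h \<tau> \<partial>lborel)"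
    proof (rule integral_mono)
      fix \<tau>
      show "norm (f q \<tau>) \<le> (P / L ^ q * \<bar>c q\<bar> * M) * h \<tau>"
      proof (cases "\<tau> \<in> {t..b}")
        case True
        then have \<tau>: "\<tau> > 0" using assms by auto
        have "norm (f q \<tau>) = (P / L ^ q * \<bar>c q\<bar>) * (ln (b / \<tau>) ^ q / \<tau>) * \<bar>x \<tau>\<bar>"
          using True \<tau> L P ln_nonneg[OF True]
          by (simp add: f_def g_def abs_mult power_abs)
        also have "\<dots> \<le> (P / L ^ q * \<bar>c q\<bar>) * (ln (b / \<tau>) ^ q / \<tau>) * M"
          using M[OF True] \<tau> L P ln_nonneg[OF True] by (intro mult_left_mono) auto
        finally show ?thesis using True by (simp add: h_def mult_ac)
      qed (simp add: f_def h_def)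
    qed (use f_int h_int in auto)
    also have "\<dots> = (P / L ^ q * \<bar>c q\<bar> * M) * (L ^ Suc q / real (Suc q))"
      using integral_ln_power_over[of t b q] assms
      unfolding integral_mult_right_zero h_def set_lebesgue_integral_def L_def by simp
    also have "\<dots> = P * M * L * (\<bar>c q\<bar> / real (Suc q))"
      using L by (simp del: of_nat_Suc)
    finally show ?thesis .
  qed
  \<comment> \<open>At \<tau> = t the ratio z equals 1 and the binomial series may diverge; this
    null set is discarded.\<close>
  have "AE \<tau> in lborel. \<tau> \<noteq> t"
    by (rule AE_lborel_singleton)
  then have f_sum: "AE \<tau> in lborel. summable (\<lambda>q. norm (f q \<tau>)) \<and>
      (\<Sum>q. f q \<tau>) = indicator {t..b} \<tau> *\<^sub>R (ln (\<tau> / t) powr (\<alpha> - 1) * (x \<tau> / \<tau>))"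
  proof eventually_elim
    case (elim \<tau>)
    show ?case
    proof (cases "\<tau> \<in> {t..b}")
      case True
      then have "t < \<tau>" "\<tau> \<le> b" using elim by auto
      note kernel = ln_kernel_sums[OF \<open>0 < t\<close> this, of \<alpha>, folded L_def, folded P_def]
      have f_alt: "f q \<tau> = P * (x \<tau> / \<tau>) * (c q * (ln (b / \<tau>) / L) ^ q)" for q
        using True by (simp add: f_def g_def power_divide mult_ac)
      have "(\<lambda>q. f q \<tau>) sums (P * (x \<tau> / \<tau>) * (ln (\<tau> / t) powr (\<alpha> - 1) / P))"
        unfolding f_alt c_def by (intro sums_mult kernel)
      moreover have "summable (\<lambda>q. norm (f q \<tau>))"
        \<comment> \<open>Only the factor constant in q is split off, so that the rest matches the
          absolute convergence in \<open>kernel\<close>.\<close>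
        unfolding f_alt c_def norm_mult[of "P * (x \<tau> / \<tau>)"] real_norm_def[of "_ * _ ^ _"]
        by (intro summable_mult kernel)
      ultimately show ?thesis using True P by (auto simp: sums_iff)
    qed (simp add: f_def)
  qed
  have "summable (\<lambda>q. \<integral>\<tau>. norm (f q \<tau>) \<partial>lborel)"
  proof (rule summable_comparison_test')
    show "summable (\<lambda>q. P * M * L * (\<bar>c q\<bar> / real (Suc q)))"
      unfolding c_def by (intro summable_mult summable_pochhammer_over_fact_Suc \<open>\<alpha> > 0\<close>)
    show "norm (\<integral>\<tau>. norm (f q \<tau>) \<partial>lborel) \<le> P * M * L * (\<bar>c q\<bar> / real (Suc q))"
      if "q \<ge> 0" for q
      using norm_le[of q] by simp
  qed
  then have "(\<lambda>q. integral\<^sup>L lborel (f q)) sums (\<integral>\<tau>. (\<Sum>q. f q \<tau>) \<partial>lborel)"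
    using f_sum by (intro sums_integral f_int) auto
  moreover have "(\<integral>\<tau>. (\<Sum>q. f q \<tau>) \<partial>lborel)
      = (LBINT \<tau>:{t..b}. ln (\<tau> / t) powr (\<alpha> - 1) * (x \<tau> / \<tau>))"
    unfolding set_lebesgue_integral_def
  proof (rule integral_cong_AE)
    \<comment> \<open>Outside the interval x is arbitrary, so measurability is taken from the
      cut-off quotient x \<tau> / \<tau>, which is \<open>g 0\<close>.\<close>
    have [measurable]: "(\<lambda>\<tau>. indicator {t..b} \<tau> *\<^sub>R g 0 \<tau>) \<in> borel_measurable lborel"
      using g_int[of 0] unfolding set_integrable_def by (rule borel_measurable_integrable)
    have "(\<lambda>\<tau>. ln (\<tau> / t) powr (\<alpha> - 1) * (indicator {t..b} \<tau> *\<^sub>R g 0 \<tau>))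
        \<in> borel_measurable lborel"
      by measurable
    then show "(\<lambda>\<tau>. indicator {t..b} \<tau> *\<^sub>R (ln (\<tau> / t) powr (\<alpha> - 1) * (x \<tau> / \<tau>)))
        \<in> borel_measurable lborel"
      by (simp add: g_def mult_ac)
  qed (use f_sum f_int in \<open>auto intro!: borel_measurable_suminf\<close>)
  ultimately show ?thesis
    unfolding f_integral by (simp add: c_def g_def P_def L_def)
qed

section \<open>The coefficients in Pochhammer form and the conclusion\<close>

lemma C_class_imp_continuous_on: "C_class k S f \<Longrightarrow> continuous_on S f"
  by (cases k) (auto intro: DERIV_continuous_on)

lemma A_term_eq:
  assumes "i \<le> n"
  shows "A_term \<alpha> n i (n - i + 1 + k) = pochhammer (- (\<alpha> + real i)) (Suc k) / fact (Suc k)"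
proof -
  have "n - i + 1 + k + i - n = Suc k" using assms by simp
  then show ?thesis
    using assms gamma_quot_A_eq_prod[of n "n - i + 1 + k" i \<alpha>]
    by (simp add: A_term_def pochhammer_prod atLeast0LessThan del: fact_Suc)
qed

lemma A_term_sums:
  assumes "\<alpha> > 0" "i \<le> n"
  shows "(\<lambda>k. A_term \<alpha> n i (n - i + 1 + k)) sums - 1"
  using sums_pochhammer_over_fact[of "\<alpha> + real i"] assms
  \<comment> \<open>The series starts at index 1 of the binomial series, whose sum is 0 and whose
    omitted first term is 1.\<close>
  by (subst A_term_eq[OF \<open>i \<le> n\<close>], subst sums_Suc_iff) auto

lemma B_coeff_eq:
  "B_coeff \<alpha> n (n + 1 + q) = pochhammer (1 - \<alpha>) q / (Gamma \<alpha> * fact (Suc q))"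
proof -
  have "(\<Prod>j=1..q. real j - \<alpha>) = pochhammer (1 - \<alpha>) q"
    unfolding pochhammer_prod
    by (rule prod.reindex_bij_witness[of _ Suc "\<lambda>j. j - 1"]) (auto simp: of_nat_diff)
  then show ?thesis
    using gamma_quot_B_eq_prod[of n "n + 1 + q" \<alpha>] by (simp add: B_coeff_def)
qed

text \<open>The factor p - n = \<open>Suc q\<close> of the moment reduces
  \<open>fact (Suc q)\<close> in the coefficient to \<open>fact q\<close>, leaving the binomial
  coefficient of the kernel expansion.\<close>

lemma B_term_eq:
  assumes "0 < t" "t < b"
  shows "B_term \<alpha> b x n t (n + 1 + q) =
    1 / Gamma \<alpha> * (pochhammer (1 - \<alpha>) q / fact q * (ln (b / t) powr (\<alpha> - 1) / ln (b / t) ^ q) *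
      (LBINT \<tau>:{t..b}. ln (b / \<tau>) ^ q * (x \<tau> / \<tau>)))"
proof -
  have L: "ln (b / t) > 0" using assms by simp
  have "W_moment b x n (n + 1 + q) t = real (Suc q) * (LBINT \<tau>:{t..b}. ln (b / \<tau>) ^ q * (x \<tau> / \<tau>))"
    unfolding W_moment_def set_integral_mult_right[symmetric] by (simp add: mult.assoc del: of_nat_Suc)
  moreover have "ln (b / t) powr (\<alpha> + real n - real (n + 1 + q))
      = ln (b / t) powr (\<alpha> - 1) / ln (b / t) ^ q"
    using L by (simp add: powr_diff[symmetric] powr_realpow[symmetric] algebra_simps)
  ultimately show ?thesis
    unfolding B_term_def B_coeff_eq fact_Suc by (simp add: divide_simps del: of_nat_Suc)
qed

theorem theorem3p3:
  fixes \<alpha> a b t :: real and n :: nat and x :: "real \<Rightarrow> real"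
  assumes "\<alpha> > 0" and "n \<ge> 1" and "0 < a" and "a < b"
    and "C_class (n + 1) {a..b} x"
    and "t \<in> {a<..<b}"
  shows "(\<forall>i\<le>n. summable (\<lambda>k. A_term \<alpha> n i (n - i + 1 + k))) \<and>
         summable (\<lambda>k. B_term \<alpha> b x n t (n + 1 + k)) \<and>
         right_hadamard_integral \<alpha> b x t =
           (\<Sum>i=0..n. A_coeff \<alpha> n i * ln (b / t) powr (\<alpha> + real i) * x_deriv i x t)
           + (\<Sum>k. B_term \<alpha> b x n t (n + 1 + k))"
proof -
  have t: "0 < t" "t < b" using assms by auto
  have cont: "continuous_on {t..b} x"
    using assms by (intro continuous_on_subset[OF C_class_imp_continuous_on[OF assms(5)]]) auto
  have A: "(\<lambda>k. A_term \<alpha> n i (n - i + 1 + k)) sums - 1" if "i \<le> n" for i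
    using A_term_sums \<open>\<alpha> > 0\<close> that by blast
  \<comment> \<open>The bracket is 1 + (-1), so the finite sum in the claim is 0 and the B series
    must equal the whole integral.\<close>
  have "A_coeff \<alpha> n i = 0" if "i \<le> n" for i
    unfolding A_coeff_def sums_unique[OF A[OF that], symmetric] by simp
  moreover have "(\<lambda>k. B_term \<alpha> b x n t (n + 1 + k)) sums right_hadamard_integral \<alpha> b x t"
    unfolding right_hadamard_integral_def B_term_eq[OF t]
    by (intro sums_mult ln_kernel_integral_sums \<open>\<alpha> > 0\<close> t cont)
  ultimately show ?thesis
    using A by (auto simp: sums_iff)
qed

end
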